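(* Let $X$ be a directed simplicial complex and let $R$ be a commutative ring. Then $H_0(X,R)\cong R^k$, where $k$ is the number of (weakly) connected components of $X$. Furthermore, if $R\in\{\mathbb{Z},\mathbb{Q},\mathbb{R}\}$, then $H_0(X,R)=H_0^{\mathrm{Dir}}(X,R)\cong R^k$.
   Context: A directed simplicial complex $X$ on a finite vertex set $V$ is a family of tuples $(x_0,\dots,x_n)$, $n\ge 0$, of elements of $V$ such that, for $n\geq 1$, if $(x_0,\dots,x_n)\in X$ then $(x_0,\dots,\widehat{x_i},\dots,x_n)\in X$ for all $i$ ($\widehat{x_i}$ means $x_i$ is omitted). Repetitions of vertices are allowed, and every vertex belongs to at least one simplex. Tuples of length $n+1$ are called $n$-simplices. A path from $v$ to $w$ in $X$ is a sequence of vertices $v=x_0,x_1,\dots,x_n=w$ such that for each $0\le i\le n-1$ either $(x_i,x_{i+1})$ or $(x_{i+1},x_i)$ is a simplex of $X$. The (weakly) connected components of $X$ are the equivalence classes of the relation on vertices: $v\sim w$ if there is a path from $v$ to $w$. For a commutative ring $R$, $C_n(X,R)$ is the free $R$-module with basis the elementary $n$-chains $[x_0,\dots,x_n]$, one for each $n$-simplex; $\partial_n[x_0,\dots,x_n]=\sum_{i=0}^n(-1)^i[x_0,\dots,\widehat{x_i},\dots,x_n]$ for $n>0$, $\partial_0=0$; $Z_n(X,R)=\ker\partial_n$, $B_n(X,R)=\operatorname{Im}\partial_{n+1}$, $H_n(X,R)=Z_n(X,R)/B_n(X,R)$. For $R\in\{\mathbb{Z},\mathbb{Q},\mathbb{R}\}$,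 $Z_n^{\mathrm{Dir}}(X,R)$ is the set of cycles $\sum_i\lambda_ic_i\in Z_n(X,R)$ with each $c_i$ an elementary $n$-chain and each $\lambda_i\ge0$, and $H_n^{\mathrm{Dir}}(X,R)$ is the $R$-submodule of $H_n(X,R)$ generated by the classes of elements of $Z_n^{\mathrm{Dir}}(X,R)$. *)

theory Defs
  imports "HOL-Algebra.Module" "HOL-Algebra.AbelCoset" "HOL-Algebra.Algebraic_Closure_Type"
begin

section \<open>Directed simplicial complexes and weakly connected components\<close>

definition del_nth :: "nat \<Rightarrow> 'v list \<Rightarrow> 'v list" where
  "del_nth i xs = take i xs @ drop (Suc i) xs"

locale directed_simplicial_complex =
  fixes V :: "'v set" and K :: "'v list set"
  assumes finite_vertices: "finite V"
    and simplices_in_vertices: "xs \<in> K \<Longrightarrow> xs \<noteq> [] \<and> set xs \<subseteq> V"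
    and face_closed: "xs \<in> K \<Longrightarrow> 2 \<le> length xs \<Longrightarrow> i < length xs \<Longrightarrow> del_nth i xs \<in> K"
    and vertex_in_simplex: "v \<in> V \<Longrightarrow> \<exists>xs\<in>K. v \<in> set xs"

definition simplices :: "'v list set \<Rightarrow> nat \<Rightarrow> 'v list set" where
  "simplices K n = {xs \<in> K. length xs = Suc n}"

definition is_path :: "'v set \<Rightarrow> 'v list set \<Rightarrow> 'v list \<Rightarrow> 'v \<Rightarrow> 'v \<Rightarrow> bool" where
  "is_path V K p v w \<longleftrightarrow>
     p \<noteq> [] \<and> hd p = v \<and> last p = w \<and> set p \<subseteq> V \<and>
     successively (\<lambda>x y. [x, y] \<in> K \<or> [y, x] \<in> K) p"

definition path_rel :: "'v set \<Rightarrow> 'v list set \<Rightarrow> ('v \<times> 'v) set" where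
  "path_rel V K = {(v, w). v \<in> V \<and> w \<in> V \<and> (\<exists>p. is_path V K p v w)}"

definition weak_components :: "'v set \<Rightarrow> 'v list set \<Rightarrow> 'v set set" where
  "weak_components V K = V // path_rel V K"


section \<open>Free modules, quotients, generated submodules, isomorphism\<close>

text \<open>The record type of modules extends that of rings. The multiplicative fields \<open>mult\<close> and
  \<open>one\<close> play no role in the \<open>module\<close> locale and are left \<open>undefined\<close> below.\<close>

definition free_module :: "('r, 'm) ring_scheme \<Rightarrow> 's set \<Rightarrow> ('r, 's \<Rightarrow> 'r) module" where
  "free_module R S = \<lparr>
     carrier = {c. (\<forall>s\<in>S. c s \<in> carrier R) \<and> (\<forall>s. s \<notin> S \<longrightarrow> c s = \<zero>\<^bsub>R\<^esub>) \<and> finite {s. c s \<noteq> \<zero>\<^bsub>R\<^esub>}},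
     monoid.mult = undefined, monoid.one = undefined,
     ring.zero = (\<lambda>s. \<zero>\<^bsub>R\<^esub>), ring.add = (\<lambda>c d s. c s \<oplus>\<^bsub>R\<^esub> d s),
     module.smult = (\<lambda>a c s. a \<otimes>\<^bsub>R\<^esub> c s)\<rparr>"

definition basis_elem :: "('r, 'm) ring_scheme \<Rightarrow> 's \<Rightarrow> 's \<Rightarrow> 'r" where
  "basis_elem R s = (\<lambda>t. if t = s then \<one>\<^bsub>R\<^esub> else \<zero>\<^bsub>R\<^esub>)"

abbreviation power_module :: "('r, 'm) ring_scheme \<Rightarrow> nat \<Rightarrow> ('r, nat \<Rightarrow> 'r) module" where
  "power_module R k \<equiv> free_module R {..<k}"

definition quotient_module :: "('r, 'b) module \<Rightarrow> 'b set \<Rightarrow> ('r, 'b set) module" where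
  "quotient_module M B = \<lparr>
     carrier = a_rcosets\<^bsub>M\<^esub> B,
     monoid.mult = undefined, monoid.one = undefined,
     ring.zero = B, ring.add = (\<lambda>A A'. A <+>\<^bsub>M\<^esub> A'),
     module.smult = (\<lambda>a A. \<Union>x\<in>A. B +>\<^bsub>M\<^esub> (a \<odot>\<^bsub>M\<^esub> x))\<rparr>"

definition generated_submodule :: "('r, 'm) ring_scheme \<Rightarrow> ('r, 'b) module \<Rightarrow> 'b set \<Rightarrow> 'b set" where
  "generated_submodule R M S = \<Inter>{N. submodule N R M \<and> S \<subseteq> N}"

definition linear_maps ::
    "('r, 'm) ring_scheme \<Rightarrow> ('r, 'b) module \<Rightarrow> ('r, 'c) module \<Rightarrow> ('b \<Rightarrow> 'c) set" where
  "linear_maps R M N =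
     {h. h \<in> carrier M \<rightarrow> carrier N \<and>
         (\<forall>x\<in>carrier M. \<forall>y\<in>carrier M. h (x \<oplus>\<^bsub>M\<^esub> y) = h x \<oplus>\<^bsub>N\<^esub> h y) \<and>
         (\<forall>a\<in>carrier R. \<forall>x\<in>carrier M. h (a \<odot>\<^bsub>M\<^esub> x) = a \<odot>\<^bsub>N\<^esub> h x)}"

definition modules_isomorphic ::
    "('r, 'm) ring_scheme \<Rightarrow> ('r, 'b) module \<Rightarrow> ('r, 'c) module \<Rightarrow> bool" where
  "modules_isomorphic R M N \<longleftrightarrow>
     module R M \<and> module R N \<and> (\<exists>h\<in>linear_maps R M N. bij_betw h (carrier M) (carrier N))"


section \<open>Homology and directed homology\<close>

abbreviation chain_module ::
    "('r, 'm) ring_scheme \<Rightarrow> 'v list set \<Rightarrow> nat \<Rightarrow> ('r, 'v list \<Rightarrow> 'r) module" where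
  "chain_module R K n \<equiv> free_module R (simplices K n)"

definition boundary_elem ::
    "('r, 'm) ring_scheme \<Rightarrow> 'v list set \<Rightarrow> nat \<Rightarrow> 'v list \<Rightarrow> ('v list \<Rightarrow> 'r)" where
  "boundary_elem R K n s =
     (let C = chain_module R K (n - 1)
      in \<Oplus>\<^bsub>C\<^esub>i\<in>{..n}. ((\<ominus>\<^bsub>R\<^esub> \<one>\<^bsub>R\<^esub>) [^]\<^bsub>R\<^esub> i) \<odot>\<^bsub>C\<^esub> basis_elem R (del_nth i s))"

text \<open>The map from \<open>n\<close>-chains to \<open>(n - 1)\<close>-chains. For \<open>n = 0\<close>, truncated subtraction makes the
  nominal codomain the module of \<open>0\<close>-chains, on which the boundary map is zero.\<close>

definition boundary_map ::
    "('r, 'm) ring_scheme \<Rightarrow> 'v list set \<Rightarrow> nat \<Rightarrow> ('v list \<Rightarrow> 'r) \<Rightarrow> ('v list \<Rightarrow> 'r)" where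
  "boundary_map R K n c =
     (let C = chain_module R K (n - 1)
      in if n = 0 then \<zero>\<^bsub>C\<^esub>
         else \<Oplus>\<^bsub>C\<^esub>s\<in>{s. c s \<noteq> \<zero>\<^bsub>R\<^esub>}. c s \<odot>\<^bsub>C\<^esub> boundary_elem R K n s)"

definition cycles :: "('r, 'm) ring_scheme \<Rightarrow> 'v list set \<Rightarrow> nat \<Rightarrow> ('v list \<Rightarrow> 'r) set" where
  "cycles R K n =
     a_kernel (chain_module R K n) (chain_module R K (n - 1)) (boundary_map R K n)"

definition boundaries :: "('r, 'm) ring_scheme \<Rightarrow> 'v list set \<Rightarrow> nat \<Rightarrow> ('v list \<Rightarrow> 'r) set" where
  "boundaries R K n = boundary_map R K (Suc n) ` carrier (chain_module R K (Suc n))"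

definition cycle_module ::
    "('r, 'm) ring_scheme \<Rightarrow> 'v list set \<Rightarrow> nat \<Rightarrow> ('r, 'v list \<Rightarrow> 'r) module" where
  "cycle_module R K n = (chain_module R K n)\<lparr>carrier := cycles R K n\<rparr>"

definition homology ::
    "('r, 'm) ring_scheme \<Rightarrow> 'v list set \<Rightarrow> nat \<Rightarrow> ('r, ('v list \<Rightarrow> 'r) set) module" where
  "homology R K n = quotient_module (cycle_module R K n) (boundaries R K n)"

definition homology_class ::
    "('r, 'm) ring_scheme \<Rightarrow> 'v list set \<Rightarrow> nat \<Rightarrow> ('v list \<Rightarrow> 'r) \<Rightarrow> ('v list \<Rightarrow> 'r) set" where
  "homology_class R K n z = boundaries R K n +>\<^bsub>cycle_module R K n\<^esub> z"

text \<open>The order on coefficients is that of the underlying type; the directed notions are meant for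
  \<open>R = ring_of_type_algebra\<close> over \<open>int\<close>, \<open>rat\<close> and \<open>real\<close>.\<close>

definition dir_cycles ::
    "('r::linordered_idom, 'm) ring_scheme \<Rightarrow> 'v list set \<Rightarrow> nat \<Rightarrow> ('v list \<Rightarrow> 'r) set" where
  "dir_cycles R K n = {z \<in> cycles R K n. \<forall>s\<in>simplices K n. 0 \<le> z s}"

definition dir_homology ::
    "('r::linordered_idom, 'm) ring_scheme \<Rightarrow> 'v list set \<Rightarrow> nat
       \<Rightarrow> ('r, ('v list \<Rightarrow> 'r) set) module" where
  "dir_homology R K n =
     (homology R K n)\<lparr>carrier :=
        generated_submodule R (homology R K n) (homology_class R K n ` dir_cycles R K n)\<rparr>"

end

theory Submission
  imports Defs
begin

text \<open>
  In degree zero every chain is a cycle, so the homology is the quotient of the free module on the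
  vertices by the boundaries, which are generated by the differences \<open>[y] - [x]\<close> over the edges
  \<open>[x, y]\<close>. Dividing by them identifies exactly the vertices joined by a path, so the components
  should form a basis of the quotient.

  To make this precise, number the components by \<open>{..<k}\<close> and pick a vertex in each. Let \<open>\<epsilon>\<close>
  send a vertex to the basis vector of its component and let \<open>\<sigma>\<close> send the \<open>j\<close>-th basis vector to
  the chosen vertex of the \<open>j\<close>-th component; both extend linearly. Then \<open>\<epsilon> \<circ> \<sigma>\<close> is the identity,
  which makes \<open>\<epsilon>\<close> surjective, and \<open>\<epsilon>\<close> kills boundaries because the ends of an edge share a
  component. Conversely \<open>\<sigma> (\<epsilon> c)\<close> is homologous to \<open>c\<close>: for a vertex this holds because the
  class of a vertex is constant along paths (\<open>path_invariant\<close>). So \<open>\<epsilon> c = 0\<close> forces \<open>c\<close> to be a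
  boundary, and the first isomorphism theorem for modules gives \<open>homology_0_iso\<close>. Each of these
  identities relates two linear maps on a free module, so comparing them on basis elements
  (\<open>linear_maps_eqI\<close>) suffices.

  For ordered coefficients, a single vertex is a cycle with nonnegative coefficients, and the
  classes of vertices generate the homology. Hence the directed submodule is everything.
\<close>

section \<open>Linear maps and quotient modules\<close>

lemma linear_mapsD:
  assumes "f \<in> linear_maps R M N"
  shows "x \<in> carrier M \<Longrightarrow> f x \<in> carrier N"
    and "x \<in> carrier M \<Longrightarrow> y \<in> carrier M \<Longrightarrow> f (x \<oplus>\<^bsub>M\<^esub> y) = f x \<oplus>\<^bsub>N\<^esub> f y"
    and "a \<in> carrier R \<Longrightarrow> x \<in> carrier M \<Longrightarrow> f (a \<odot>\<^bsub>M\<^esub> x) = a \<odot>\<^bsub>N\<^esub> f x"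
  using assms by (auto simp: linear_maps_def)

lemma linear_maps_zero:
  assumes "module R M" "module R N" "f \<in> linear_maps R M N"
  shows "f \<zero>\<^bsub>M\<^esub> = \<zero>\<^bsub>N\<^esub>"
proof -
  interpret M: module R M by fact
  interpret N: module R N by fact
  have "f (\<zero>\<^bsub>R\<^esub> \<odot>\<^bsub>M\<^esub> \<zero>\<^bsub>M\<^esub>) = \<zero>\<^bsub>R\<^esub> \<odot>\<^bsub>N\<^esub> f \<zero>\<^bsub>M\<^esub>"
    by (intro linear_mapsD[OF assms(3)]) auto
  then show ?thesis
    using linear_mapsD(1)[OF assms(3), of "\<zero>\<^bsub>M\<^esub>"] by simp
qed

lemma linear_maps_minus:
  assumes "module R M" "module R N" "f \<in> linear_maps R M N"
    and "x \<in> carrier M" "y \<in> carrier M"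
  shows "f (x \<ominus>\<^bsub>M\<^esub> y) = f x \<ominus>\<^bsub>N\<^esub> f y"
proof -
  interpret M: module R M by fact
  interpret N: module R N by fact
  note lin = linear_mapsD[OF assms(3)]
  \<comment> \<open>Negatives are preserved because they are multiples by \<open>-1\<close>.\<close>
  have minus_one: "\<ominus>\<^bsub>M\<^esub> y = (\<ominus>\<^bsub>R\<^esub> \<one>\<^bsub>R\<^esub>) \<odot>\<^bsub>M\<^esub> y"
    using assms by (simp add: M.smult_l_minus)
  have "f (\<ominus>\<^bsub>M\<^esub> y) = \<ominus>\<^bsub>N\<^esub> f y"
    unfolding minus_one using assms by (simp add: lin N.smult_l_minus)
  then show ?thesis
    using assms by (simp add: lin M.minus_eq N.minus_eq)
qed

lemma linear_maps_compose:
  assumes "f \<in> linear_maps R L M" "g \<in> linear_maps R M N"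
  shows "(\<lambda>x. g (f x)) \<in> linear_maps R L N"
  using assms by (auto simp: linear_maps_def Pi_iff)

lemma linear_image_submodule:
  assumes "module R M" "module R N" "f \<in> linear_maps R M N"
  shows "submodule (f ` carrier M) R N"
proof -
  interpret M: module R M by fact
  interpret N: module R N by fact
  note lin = linear_mapsD[OF assms(3)]
  show ?thesis
  proof (rule N.submoduleI)
    show "f ` carrier M \<subseteq> carrier N"
      using lin by auto
    show "\<zero>\<^bsub>N\<^esub> \<in> f ` carrier M"
      using linear_maps_zero[OF assms] by (metis M.M.zero_closed image_eqI)
    show "\<ominus>\<^bsub>N\<^esub> y \<in> f ` carrier M" if "y \<in> f ` carrier M" for y
    proof -
      from that obtain x where x: "x \<in> carrier M" "y = f x" by auto
      then have "\<ominus>\<^bsub>N\<^esub> y = f (\<zero>\<^bsub>M\<^esub> \<ominus>\<^bsub>M\<^esub> x)"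
        using linear_maps_minus[OF assms, of "\<zero>\<^bsub>M\<^esub>" x] linear_maps_zero[OF assms] lin(1)[of x]
        by (simp add: N.minus_eq)
      then show ?thesis using x by blast
    qed
    show "y \<oplus>\<^bsub>N\<^esub> y' \<in> f ` carrier M" if "y \<in> f ` carrier M" "y' \<in> f ` carrier M" for y y'
      using that by (auto simp: lin(2)[symmetric])
    show "a \<odot>\<^bsub>N\<^esub> y \<in> f ` carrier M" if "a \<in> carrier R" "y \<in> f ` carrier M" for a y
      using that by (auto simp: lin(3)[symmetric])
  qed
qed

lemma submodule_imp_abelian_subgroup:
  assumes "module R M" "submodule B R M"
  shows "abelian_subgroup B M"
  using assms
  by (intro abelian_subgroupI3 additive_subgroup.intro)
     (auto simp: submodule_def module_def)

text \<open>Computing in the quotient through representatives. The zero is the coset of zero and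
  scalar multiplication, a union over all elements of a coset, collapses to the coset of a single
  multiple because \<open>B\<close> absorbs the differences.\<close>

lemma quotient_module_simps:
  assumes "module R M" "submodule B R M"
  shows "carrier (quotient_module M B) = (\<lambda>x. B +>\<^bsub>M\<^esub> x) ` carrier M"
    and "\<zero>\<^bsub>quotient_module M B\<^esub> = B +>\<^bsub>M\<^esub> \<zero>\<^bsub>M\<^esub>"
    and "x \<in> carrier M \<Longrightarrow> y \<in> carrier M \<Longrightarrow>
          (B +>\<^bsub>M\<^esub> x) \<oplus>\<^bsub>quotient_module M B\<^esub> (B +>\<^bsub>M\<^esub> y) = B +>\<^bsub>M\<^esub> (x \<oplus>\<^bsub>M\<^esub> y)"
    and "a \<in> carrier R \<Longrightarrow> x \<in> carrier M \<Longrightarrow>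
          a \<odot>\<^bsub>quotient_module M B\<^esub> (B +>\<^bsub>M\<^esub> x) = B +>\<^bsub>M\<^esub> (a \<odot>\<^bsub>M\<^esub> x)"
proof -
  interpret M: module R M by fact
  interpret B: abelian_subgroup B M by (rule submodule_imp_abelian_subgroup) fact+
  note sub = M.submoduleE[OF assms(2)]
  show "carrier (quotient_module M B) = (\<lambda>x. B +>\<^bsub>M\<^esub> x) ` carrier M"
    by (auto simp: quotient_module_def A_RCOSETS_def')
  show "\<zero>\<^bsub>quotient_module M B\<^esub> = B +>\<^bsub>M\<^esub> \<zero>\<^bsub>M\<^esub>"
    using sub(1) by (simp add: quotient_module_def)
  show "(B +>\<^bsub>M\<^esub> x) \<oplus>\<^bsub>quotient_module M B\<^esub> (B +>\<^bsub>M\<^esub> y) = B +>\<^bsub>M\<^esub> (x \<oplus>\<^bsub>M\<^esub> y)"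
    if "x \<in> carrier M" "y \<in> carrier M"
    using that by (simp add: quotient_module_def B.a_rcos_sum)
  assume a: "a \<in> carrier R" and x: "x \<in> carrier M"
  have const: "B +>\<^bsub>M\<^esub> (a \<odot>\<^bsub>M\<^esub> y) = B +>\<^bsub>M\<^esub> (a \<odot>\<^bsub>M\<^esub> x)" if y: "y \<in> B +>\<^bsub>M\<^esub> x" for y
  proof -
    from y obtain b where b: "b \<in> B" "y = b \<oplus>\<^bsub>M\<^esub> x"
      by (auto simp: a_r_coset_def')
    have "a \<odot>\<^bsub>M\<^esub> y = (a \<odot>\<^bsub>M\<^esub> b) \<oplus>\<^bsub>M\<^esub> (a \<odot>\<^bsub>M\<^esub> x)"
      using a x b sub(1) by (auto simp: M.smult_r_distr)
    moreover have "a \<odot>\<^bsub>M\<^esub> b \<in> B"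
      using a b sub(4) by blast
    ultimately have "a \<odot>\<^bsub>M\<^esub> y \<in> B +>\<^bsub>M\<^esub> (a \<odot>\<^bsub>M\<^esub> x)"
      by (auto simp: a_r_coset_def')
    then show ?thesis
      using B.a_repr_independence'[OF _ M.smult_closed[OF a x]] by simp
  qed
  have "(\<Union>y\<in>B +>\<^bsub>M\<^esub> x. B +>\<^bsub>M\<^esub> (a \<odot>\<^bsub>M\<^esub> y)) =
      (\<Union>y\<in>B +>\<^bsub>M\<^esub> x. B +>\<^bsub>M\<^esub> (a \<odot>\<^bsub>M\<^esub> x))"
    by (intro SUP_cong refl const)
  also have "\<dots> = B +>\<^bsub>M\<^esub> (a \<odot>\<^bsub>M\<^esub> x)"
    using B.a_rcos_self[OF x] by blast
  finally show "a \<odot>\<^bsub>quotient_module M B\<^esub> (B +>\<^bsub>M\<^esub> x) = B +>\<^bsub>M\<^esub> (a \<odot>\<^bsub>M\<^esub> x)"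
    by (simp add: quotient_module_def)
qed

lemma module_quotient_module:
  assumes "module R M" "submodule B R M"
  shows "module R (quotient_module M B)"
proof -
  interpret M: module R M by fact
  note q = quotient_module_simps[OF assms]
  show ?thesis
  proof (intro moduleI abelian_groupI)
    show "cring R" ..
    fix A assume "A \<in> carrier (quotient_module M B)"
    then obtain x where x: "x \<in> carrier M" "A = B +>\<^bsub>M\<^esub> x" by (auto simp: q(1))
    then have "(B +>\<^bsub>M\<^esub> (\<ominus>\<^bsub>M\<^esub> x)) \<oplus>\<^bsub>quotient_module M B\<^esub> A = \<zero>\<^bsub>quotient_module M B\<^esub>"
      by (simp add: q M.M.l_neg)
    with x show "\<exists>A'\<in>carrier (quotient_module M B).
        A' \<oplus>\<^bsub>quotient_module M B\<^esub> A = \<zero>\<^bsub>quotient_module M B\<^esub>"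
      by (auto simp: q(1))
  qed (auto simp: q M.M.a_ac M.smult_l_distr M.smult_r_distr M.smult_assoc1)
qed

lemma coset_map_linear:
  assumes "module R M" "submodule B R M"
  shows "(\<lambda>x. B +>\<^bsub>M\<^esub> x) \<in> linear_maps R M (quotient_module M B)"
  by (simp add: linear_maps_def quotient_module_simps[OF assms])

lemma coset_eq_iff:
  assumes "module R M" "submodule B R M" "x \<in> carrier M" "y \<in> carrier M"
  shows "B +>\<^bsub>M\<^esub> x = B +>\<^bsub>M\<^esub> y \<longleftrightarrow> x \<ominus>\<^bsub>M\<^esub> y \<in> B"
proof -
  interpret M: module R M by fact
  interpret B: abelian_subgroup B M by (rule submodule_imp_abelian_subgroup) fact+
  have "B +>\<^bsub>M\<^esub> x = B +>\<^bsub>M\<^esub> y \<longleftrightarrow> x \<in> B +>\<^bsub>M\<^esub> y"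
    using assms by (metis B.a_rcos_self B.a_repr_independence')
  also have "\<dots> \<longleftrightarrow> x \<ominus>\<^bsub>M\<^esub> y \<in> B"
    using assms by (simp add: B.a_rcos_module M.minus_eq)
  finally show ?thesis .
qed

text \<open>The induced map reads off \<open>f\<close> on any representative of a coset; it is well defined and
  injective because two elements have the same image exactly when their difference lies in the
  kernel.\<close>

lemma first_isomorphism_theorem:
  assumes M: "module R M" and N: "module R N" and B: "submodule B R M"
    and f: "f \<in> linear_maps R M N" and surj: "f ` carrier M = carrier N"
    and ker: "\<And>x. x \<in> carrier M \<Longrightarrow> f x = \<zero>\<^bsub>N\<^esub> \<longleftrightarrow> x \<in> B"
  shows "modules_isomorphic R (quotient_module M B) N"
proof -
  interpret M: module R M by fact
  interpret N: module R N by fact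
  note q = quotient_module_simps[OF M B]
  note lin = linear_mapsD[OF f]
  have inj: "B +>\<^bsub>M\<^esub> x = B +>\<^bsub>M\<^esub> y \<longleftrightarrow> f x = f y" if "x \<in> carrier M" "y \<in> carrier M" for x y
    using that lin(1)[of x] lin(1)[of y] N.M.add.inv_solve_right[of "\<zero>\<^bsub>N\<^esub>" "f x" "f y"]
    by (auto simp: coset_eq_iff[OF M B] ker[symmetric] linear_maps_minus[OF M N f] N.minus_eq)
  define h where "h A = f (SOME x. x \<in> carrier M \<and> A = B +>\<^bsub>M\<^esub> x)" for A
  have h: "h (B +>\<^bsub>M\<^esub> x) = f x" if "x \<in> carrier M" for x
    unfolding h_def by (rule someI2[of _ x]) (use that inj in auto)
  have "h \<in> linear_maps R (quotient_module M B) N"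
    by (auto simp: linear_maps_def q h lin)
  moreover have "bij_betw h (carrier (quotient_module M B)) (carrier N)"
    unfolding bij_betw_def
  proof
    show "inj_on h (carrier (quotient_module M B))"
    proof (rule inj_onI)
      fix A A' assume "A \<in> carrier (quotient_module M B)" "A' \<in> carrier (quotient_module M B)"
        and eq: "h A = h A'"
      then obtain x x' where "x \<in> carrier M" "A = B +>\<^bsub>M\<^esub> x" "x' \<in> carrier M" "A' = B +>\<^bsub>M\<^esub> x'"
        by (auto simp: q(1))
      with eq show "A = A'" using inj[of x x'] by (simp add: h)
    qed
    show "h ` carrier (quotient_module M B) = carrier N"
      unfolding surj[symmetric] q(1) image_image by (intro image_cong) (auto simp: h)
  qed
  ultimately show ?thesis
    using N module_quotient_module[OF M B] by (auto simp: modules_isomorphic_def)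
qed


section \<open>Free modules\<close>

lemma free_module_simps [simp]:
  "\<zero>\<^bsub>free_module R S\<^esub> = (\<lambda>s. \<zero>\<^bsub>R\<^esub>)"
  "c \<oplus>\<^bsub>free_module R S\<^esub> d = (\<lambda>s. c s \<oplus>\<^bsub>R\<^esub> d s)"
  "a \<odot>\<^bsub>free_module R S\<^esub> c = (\<lambda>s. a \<otimes>\<^bsub>R\<^esub> c s)"
  by (simp_all add: free_module_def)

lemma free_module_carrier:
  "c \<in> carrier (free_module R S) \<longleftrightarrow>
     (\<forall>s\<in>S. c s \<in> carrier R) \<and> (\<forall>s. s \<notin> S \<longrightarrow> c s = \<zero>\<^bsub>R\<^esub>) \<and> finite {s. c s \<noteq> \<zero>\<^bsub>R\<^esub>}"
  by (simp add: free_module_def)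

lemma free_module_coeff_closed:
  assumes "cring R" "c \<in> carrier (free_module R S)"
  shows "c s \<in> carrier R"
proof -
  interpret cring R by fact
  show ?thesis using assms(2) by (cases "s \<in> S") (auto simp: free_module_carrier)
qed

lemma free_module_is_module:
  assumes "cring R"
  shows "module R (free_module R S)"
proof -
  interpret cring R by fact
  note coeff [simp] = free_module_coeff_closed[OF assms]
  show ?thesis
  proof (intro moduleI abelian_groupI)
    fix c d assume cd: "c \<in> carrier (free_module R S)" "d \<in> carrier (free_module R S)"
    have "finite {s. c s \<oplus>\<^bsub>R\<^esub> d s \<noteq> \<zero>\<^bsub>R\<^esub>}"
      by (rule finite_subset[of _ "{s. c s \<noteq> \<zero>\<^bsub>R\<^esub>} \<union> {s. d s \<noteq> \<zero>\<^bsub>R\<^esub>}"])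
         (use cd in \<open>auto simp: free_module_carrier\<close>)
    then show "c \<oplus>\<^bsub>free_module R S\<^esub> d \<in> carrier (free_module R S)"
      using cd by (auto simp: free_module_carrier)
  next
    fix c assume c: "c \<in> carrier (free_module R S)"
    have "finite {s. \<ominus>\<^bsub>R\<^esub> c s \<noteq> \<zero>\<^bsub>R\<^esub>}"
      by (rule finite_subset[of _ "{s. c s \<noteq> \<zero>\<^bsub>R\<^esub>}"])
         (use c in \<open>auto simp: free_module_carrier\<close>)
    then have "(\<lambda>s. \<ominus>\<^bsub>R\<^esub> c s) \<in> carrier (free_module R S)"
      using c by (auto simp: free_module_carrier)
    then show "\<exists>d\<in>carrier (free_module R S). d \<oplus>\<^bsub>free_module R S\<^esub> c = \<zero>\<^bsub>free_module R S\<^esub>"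
      using c by (intro bexI[of _ "\<lambda>s. \<ominus>\<^bsub>R\<^esub> c s"]) (simp_all add: l_neg)
    fix a assume a: "a \<in> carrier R"
    have "finite {s. a \<otimes>\<^bsub>R\<^esub> c s \<noteq> \<zero>\<^bsub>R\<^esub>}"
      by (rule finite_subset[of _ "{s. c s \<noteq> \<zero>\<^bsub>R\<^esub>}"])
         (use a c in \<open>auto simp: free_module_carrier\<close>)
    then show "a \<odot>\<^bsub>free_module R S\<^esub> c \<in> carrier (free_module R S)"
      using a c by (auto simp: free_module_carrier)
  qed (use assms in \<open>auto simp: a_ac m_assoc l_distr r_distr\<close>, auto simp: free_module_carrier)
qed

lemma basis_elem_closed:
  assumes "cring R" "s \<in> S"
  shows "basis_elem R s \<in> carrier (free_module R S)"
proof -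
  interpret cring R by fact
  have "finite {t. basis_elem R s t \<noteq> \<zero>\<^bsub>R\<^esub>}"
    by (rule finite_subset[of _ "{s}"]) (auto simp: basis_elem_def)
  then show ?thesis using assms by (auto simp: free_module_carrier basis_elem_def)
qed

text \<open>Finitely supported functions are built from multiples of basis elements: clearing one
  coefficient at a time empties the support.\<close>

lemma free_module_induct [consumes 2, case_names zero basis add]:
  assumes R: "cring R" and c: "c \<in> carrier (free_module R S)"
    and P_zero: "P \<zero>\<^bsub>free_module R S\<^esub>"
    and basis: "\<And>a s. a \<in> carrier R \<Longrightarrow> s \<in> S \<Longrightarrow>
                  P (a \<odot>\<^bsub>free_module R S\<^esub> basis_elem R s)"
    and add: "\<And>c d. c \<in> carrier (free_module R S) \<Longrightarrow> d \<in> carrier (free_module R S) \<Longrightarrow>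
                  P c \<Longrightarrow> P d \<Longrightarrow> P (c \<oplus>\<^bsub>free_module R S\<^esub> d)"
  shows "P c"
proof -
  interpret cring R by fact
  interpret F: module R "free_module R S" by (rule free_module_is_module) fact
  have "P c" if "finite A" "{s. c s \<noteq> \<zero>\<^bsub>R\<^esub>} \<subseteq> A" "c \<in> carrier (free_module R S)" for A c
    using that
  proof (induction A arbitrary: c rule: finite_induct)
    case empty
    then have "c = \<zero>\<^bsub>free_module R S\<^esub>" by auto
    then show ?case using P_zero by (simp del: free_module_simps)
  next
    case (insert s A)
    define d where "d = c(s := \<zero>\<^bsub>R\<^esub>)"
    have d: "d \<in> carrier (free_module R S)"
    proof -
      have "finite {t. d t \<noteq> \<zero>\<^bsub>R\<^esub>}"
        by (rule finite_subset[of _ "{t. c t \<noteq> \<zero>\<^bsub>R\<^esub>}"])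
           (use insert.prems in \<open>auto simp: d_def free_module_carrier\<close>)
      then show ?thesis
        using insert.prems by (auto simp: d_def free_module_carrier)
    qed
    have "P d"
      by (rule insert.IH[OF _ d]) (use insert.prems in \<open>auto simp: d_def\<close>)
    show ?case
    proof (cases "s \<in> S")
      case True
      have cs: "c s \<in> carrier R"
        using insert.prems(2) R by (blast intro: free_module_coeff_closed)
      have "c = d \<oplus>\<^bsub>free_module R S\<^esub> (c s \<odot>\<^bsub>free_module R S\<^esub> basis_elem R s)"
        using insert.prems(2) cs
        by (auto simp: fun_eq_iff d_def basis_elem_def free_module_coeff_closed[OF R])
      moreover have "P (d \<oplus>\<^bsub>free_module R S\<^esub> (c s \<odot>\<^bsub>free_module R S\<^esub> basis_elem R s))"
        using True cs d \<open>P d\<close> basis_elem_closed[OF R True]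
        by (intro add basis F.smult_closed)
      ultimately show ?thesis by simp
    next
      case False
      then have "c = d"
        using insert.prems(2) by (auto simp: d_def free_module_carrier)
      then show ?thesis using \<open>P d\<close> by simp
    qed
  qed
  from this[OF _ order_refl c] show ?thesis
    using c by (simp add: free_module_carrier)
qed

text \<open>Applied to the coset map, this says that the classes of a basis generate a quotient of the
  free module.\<close>

lemma linear_map_into_submodule:
  assumes R: "cring R" and N: "module R N" and f: "f \<in> linear_maps R (free_module R S) N"
    and H: "submodule H R N" and basis: "\<And>s. s \<in> S \<Longrightarrow> f (basis_elem R s) \<in> H"
    and c: "c \<in> carrier (free_module R S)"
  shows "f c \<in> H"
proof -
  interpret N: module R N by fact
  note F = free_module_is_module[OF R, of S]
  note sub = N.submoduleE[OF H]
  from R c show ?thesis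
  proof (induction rule: free_module_induct)
    case zero
    have "\<zero>\<^bsub>N\<^esub> \<in> H"
      using subgroup.one_closed[of H "add_monoid N"] H by (simp add: submodule_def)
    then show ?case
      by (simp only: linear_maps_zero[OF F N f])
  next
    case (basis a s)
    then show ?case
      using sub(4) assms(5) by (simp only: linear_mapsD(3)[OF f] basis_elem_closed[OF R])
  next
    case (add c d)
    then show ?case
      using sub(5) by (simp only: linear_mapsD(2)[OF f])
  qed
qed

lemma linear_maps_eqI:
  assumes R: "cring R" and N: "module R N"
    and f: "f \<in> linear_maps R (free_module R S) N" and g: "g \<in> linear_maps R (free_module R S) N"
    and basis: "\<And>s. s \<in> S \<Longrightarrow> f (basis_elem R s) = g (basis_elem R s)"
    and c: "c \<in> carrier (free_module R S)"
  shows "f c = g c"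
proof -
  note F = free_module_is_module[OF R, of S]
  from R c show ?thesis
  proof (induction rule: free_module_induct)
    case zero
    show ?case
      by (simp only: linear_maps_zero[OF F N f] linear_maps_zero[OF F N g])
  next
    case (basis a s)
    then show ?case
      using assms(5)
      by (simp only: linear_mapsD(3)[OF f] linear_mapsD(3)[OF g] basis_elem_closed[OF R])
  next
    case (add c d)
    then show ?case
      by (simp only: linear_mapsD(2)[OF f] linear_mapsD(2)[OF g])
  qed
qed

text \<open>The map out of a free module provided by its universal property. The boundary map of a
  complex in positive degree is one of these.\<close>

definition linear_extension ::
    "('r, 'm) ring_scheme \<Rightarrow> ('r, 'b) module \<Rightarrow> ('s \<Rightarrow> 'b) \<Rightarrow> ('s \<Rightarrow> 'r) \<Rightarrow> 'b" where
  "linear_extension R N g c = (\<Oplus>\<^bsub>N\<^esub>s\<in>{s. c s \<noteq> \<zero>\<^bsub>R\<^esub>}. c s \<odot>\<^bsub>N\<^esub> g s)"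

text \<open>The support varies with the chain, so sums of two chains are compared over a common finite
  superset of both supports.\<close>

lemma linear_extension_superset:
  assumes "module R N" and g: "\<And>s. s \<in> S \<Longrightarrow> g s \<in> carrier N"
    and c: "c \<in> carrier (free_module R S)"
    and A: "finite A" "{s. c s \<noteq> \<zero>\<^bsub>R\<^esub>} \<subseteq> A" "A \<subseteq> S"
  shows "linear_extension R N g c = (\<Oplus>\<^bsub>N\<^esub>s\<in>A. c s \<odot>\<^bsub>N\<^esub> g s)"
proof -
  interpret N: module R N by fact
  have "c s \<in> carrier R" if "s \<in> A" for s
    using c that A(3) by (auto simp: free_module_carrier)
  then show ?thesis
    unfolding linear_extension_def using A g
    by (intro N.M.add.finprod_mono_neutral_cong_left) auto
qed

lemma linear_extension_linear:
  assumes "module R N" and g: "\<And>s. s \<in> S \<Longrightarrow> g s \<in> carrier N"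
  shows "linear_extension R N g \<in> linear_maps R (free_module R S) N"
proof -
  interpret N: module R N by fact
  have R: "cring R" ..
  interpret F: module R "free_module R S" by (rule free_module_is_module) fact
  have ext: "linear_extension R N g c = (\<Oplus>\<^bsub>N\<^esub>s\<in>A. c s \<odot>\<^bsub>N\<^esub> g s)"
    if "c \<in> carrier (free_module R S)" "finite A"
      "{s. c s \<noteq> \<zero>\<^bsub>R\<^esub>} \<subseteq> A" "A \<subseteq> S" for c A
    using assms that by (rule linear_extension_superset)
  have supp: "{s. c s \<noteq> \<zero>\<^bsub>R\<^esub>} \<subseteq> S" "finite {s. c s \<noteq> \<zero>\<^bsub>R\<^esub>}"
    if "c \<in> carrier (free_module R S)" for c
    using that by (auto simp: free_module_carrier)
  have coeff: "c s \<in> carrier R" if "c \<in> carrier (free_module R S)" for c s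
    using that R by (rule free_module_coeff_closed[rotated])
  show ?thesis
    unfolding linear_maps_def
  proof (intro CollectI conjI ballI funcsetI)
    fix c assume c: "c \<in> carrier (free_module R S)"
    let ?A = "{s. c s \<noteq> \<zero>\<^bsub>R\<^esub>}"
    show "linear_extension R N g c \<in> carrier N"
      unfolding linear_extension_def
      using coeff[OF c] supp[OF c] g by (intro N.M.finsum_closed) blast
    {
      fix d assume d: "d \<in> carrier (free_module R S)"
      let ?B = "?A \<union> {s. d s \<noteq> \<zero>\<^bsub>R\<^esub>}"
      have B: "finite ?B" "?B \<subseteq> S" using supp[OF c] supp[OF d] by auto
      have gB: "g s \<in> carrier N" if "s \<in> ?B" for s using that B(2) g by blast
      have cd: "c \<oplus>\<^bsub>free_module R S\<^esub> d \<in> carrier (free_module R S)"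
        using c d by (rule F.M.a_closed)
      have "linear_extension R N g (c \<oplus>\<^bsub>free_module R S\<^esub> d) =
          (\<Oplus>\<^bsub>N\<^esub>s\<in>?B. (c s \<oplus>\<^bsub>R\<^esub> d s) \<odot>\<^bsub>N\<^esub> g s)"
        using cd B by (subst ext[OF cd, of ?B]) auto
      also have "\<dots> = (\<Oplus>\<^bsub>N\<^esub>s\<in>?B. c s \<odot>\<^bsub>N\<^esub> g s \<oplus>\<^bsub>N\<^esub> d s \<odot>\<^bsub>N\<^esub> g s)"
        using gB coeff[OF c] coeff[OF d]
        by (intro N.M.finsum_cong') (auto simp: N.smult_l_distr)
      also have "\<dots> = (\<Oplus>\<^bsub>N\<^esub>s\<in>?B. c s \<odot>\<^bsub>N\<^esub> g s) \<oplus>\<^bsub>N\<^esub> (\<Oplus>\<^bsub>N\<^esub>s\<in>?B. d s \<odot>\<^bsub>N\<^esub> g s)"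
        using gB coeff[OF c] coeff[OF d] by (intro N.M.finsum_addf) auto
      also have "\<dots> = linear_extension R N g c \<oplus>\<^bsub>N\<^esub> linear_extension R N g d"
        using B by (subst (1 2) ext[of _ ?B]) (use c d in auto)
      finally show "linear_extension R N g (c \<oplus>\<^bsub>free_module R S\<^esub> d) =
          linear_extension R N g c \<oplus>\<^bsub>N\<^esub> linear_extension R N g d" .
    }
    fix a assume a: "a \<in> carrier R"
    have ac: "a \<odot>\<^bsub>free_module R S\<^esub> c \<in> carrier (free_module R S)"
      using a c by (rule F.smult_closed)
    have gA: "g s \<in> carrier N" if "s \<in> ?A" for s using that supp[OF c] g by blast
    have "linear_extension R N g (a \<odot>\<^bsub>free_module R S\<^esub> c) =
        (\<Oplus>\<^bsub>N\<^esub>s\<in>?A. (a \<otimes>\<^bsub>R\<^esub> c s) \<odot>\<^bsub>N\<^esub> g s)"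
      using supp[OF c] a by (subst ext[OF ac, of ?A]) auto
    also have "\<dots> = (\<Oplus>\<^bsub>N\<^esub>s\<in>?A. a \<odot>\<^bsub>N\<^esub> (c s \<odot>\<^bsub>N\<^esub> g s))"
      using gA coeff[OF c] a by (intro N.M.finsum_cong') (auto simp: N.smult_assoc1)
    also have "\<dots> = a \<odot>\<^bsub>N\<^esub> linear_extension R N g c"
      unfolding linear_extension_def
      using gA coeff[OF c] a supp[OF c] by (intro N.finsum_smult_ldistr[symmetric]) auto
    finally show "linear_extension R N g (a \<odot>\<^bsub>free_module R S\<^esub> c) =
        a \<odot>\<^bsub>N\<^esub> linear_extension R N g c" .
  qed
qed

lemma linear_extension_basis:
  assumes "module R N" and "g s \<in> carrier N"
  shows "linear_extension R N g (basis_elem R s) = g s"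
proof -
  interpret N: module R N by fact
  have R: "cring R" ..
  have "linear_extension R N g (basis_elem R s) = (\<Oplus>\<^bsub>N\<^esub>t\<in>{s}. basis_elem R s t \<odot>\<^bsub>N\<^esub> g t)"
    by (rule linear_extension_superset[where S = "{s}"])
       (use assms basis_elem_closed[OF R, of s "{s}"] in \<open>auto simp: basis_elem_def\<close>)
  also have "\<dots> = g s"
    using assms by (simp add: basis_elem_def)
  finally show ?thesis .
qed


section \<open>Weakly connected components\<close>

context directed_simplicial_complex
begin

text \<open>Any other entry of a simplex can be deleted, until only \<open>v\<close> is left; repeated vertices do
  no harm.\<close>

lemma singleton_simplex: "xs \<in> K \<Longrightarrow> v \<in> set xs \<Longrightarrow> [v] \<in> K"
proof (induction "length xs" arbitrary: xs rule: less_induct)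
  case less
  show ?case
  proof (cases xs rule: remdups_adj.cases)
    case (3 x y ys)
    \<comment> \<open>Deleting one of the first two entries leaves a face that still contains \<open>v\<close>.\<close>
    have "x # ys \<in> K" "y # ys \<in> K"
      using face_closed[OF less.prems(1), of 1] face_closed[OF less.prems(1), of 0]
      by (simp_all add: 3 del_nth_def)
    then show ?thesis
      using less.hyps[of "x # ys"] less.hyps[of "y # ys"] less.prems(2) by (auto simp: 3)
  qed (use less.prems in auto)
qed

lemma simplices_0: "simplices K 0 = (\<lambda>v. [v]) ` V"
proof
  show "simplices K 0 \<subseteq> (\<lambda>v. [v]) ` V"
    using simplices_in_vertices by (fastforce simp: simplices_def length_Suc_conv)
  show "(\<lambda>v. [v]) ` V \<subseteq> simplices K 0"
    using vertex_in_simplex singleton_simplex by (fastforce simp: simplices_def)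
qed

lemma equiv_path_rel: "equiv V (path_rel V K)"
proof (rule equivI)
  show "path_rel V K \<subseteq> V \<times> V"
    by (auto simp: path_rel_def)
  have "is_path V K [v] v v" if "v \<in> V" for v
    using that by (simp add: is_path_def)
  then show "refl_on V (path_rel V K)"
    by (auto simp: refl_on_def path_rel_def)
  have "is_path V K (rev p) w v" if "is_path V K p v w" for p v w
    using that by (auto simp: is_path_def hd_rev last_rev disj_commute)
  then show "sym (path_rel V K)"
    by (fastforce simp: sym_def path_rel_def)
  \<comment> \<open>The common endpoint must be listed once only: \<open>[v, v]\<close> need not be a simplex.\<close>
  have "is_path V K (p @ tl q) u w" if p: "is_path V K p u v" and q: "is_path V K q v w"
    for p q u v w
  proof -
    obtain qs where "q = v # qs"
      using q by (cases q) (auto simp: is_path_def)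
    then show ?thesis
      using p q by (auto simp: is_path_def successively_append_iff successively_Cons)
  qed
  then show "trans (path_rel V K)"
    by (fastforce simp: trans_def path_rel_def)
qed

lemma edge_in_path_rel: "[x, y] \<in> K \<Longrightarrow> (x, y) \<in> path_rel V K"
  using simplices_in_vertices[of "[x, y]"]
  by (auto simp: path_rel_def is_path_def intro!: exI[of _ "[x, y]"])

text \<open>Being joined by a path is the smallest equivalence relation on the vertices that contains
  the edges, so a function constant on edges is constant on components. The direction of
  an edge does not matter, since equality is symmetric.\<close>

lemma path_invariant:
  assumes "(v, w) \<in> path_rel V K" and edge: "\<And>x y. [x, y] \<in> K \<Longrightarrow> F x = F y"
  shows "F v = F w"
proof -
  from assms(1) obtain p where "is_path V K p v w"
    by (auto simp: path_rel_def)
  then show ?thesis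
  proof (induction p arbitrary: v)
    case Nil
    then show ?case by (simp add: is_path_def)
  next
    case (Cons x p)
    show ?case
    proof (cases p)
      case Nil
      then show ?thesis using Cons.prems by (auto simp: is_path_def)
    next
      case (Cons y q)
      then have "is_path V K p y w" "[v, y] \<in> K \<or> [y, v] \<in> K"
        using Cons.prems by (auto simp: is_path_def)
      then show ?thesis
        using Cons.IH edge by metis
    qed
  qed
qed

lemma finite_weak_components: "finite (weak_components V K)"
  unfolding weak_components_def
  by (rule finite_quotient[OF finite_vertices]) (auto simp: path_rel_def)

end


section \<open>Boundaries and homology in degree zero\<close>

lemma boundary_map_eq:
  "boundary_map R K (Suc n) =
     linear_extension R (chain_module R K n) (boundary_elem R K (Suc n))"
  by (simp add: fun_eq_iff boundary_map_def linear_extension_def)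

lemma cycles_0: "cycles R K 0 = carrier (chain_module R K 0)"
  by (simp add: cycles_def a_kernel_def' boundary_map_def)

lemma cycle_module_0: "cycle_module R K 0 = chain_module R K 0"
  by (simp add: cycle_module_def cycles_0)

lemma homology_0:
  "homology R K 0 = quotient_module (chain_module R K 0) (boundaries R K 0)"
  by (simp add: homology_def cycle_module_0)

context directed_simplicial_complex
begin

lemma boundary_elem_closed:
  assumes R: "cring R" and s: "s \<in> simplices K (Suc n)"
  shows "boundary_elem R K (Suc n) s \<in> carrier (chain_module R K n)"
proof -
  interpret cring R by fact
  interpret C: module R "chain_module R K n" by (rule free_module_is_module) fact
  have face: "del_nth i s \<in> simplices K n" if "i \<le> Suc n" for i
    using s that face_closed[of s i] by (auto simp: simplices_def del_nth_def)
  show ?thesis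
    unfolding boundary_elem_def Let_def diff_Suc_1
    by (intro C.M.finsum_closed funcsetI C.smult_closed nat_pow_closed basis_elem_closed[OF R] face)
       auto
qed

lemma boundary_map_linear:
  assumes "cring R"
  shows "boundary_map R K (Suc n) \<in> linear_maps R (chain_module R K (Suc n)) (chain_module R K n)"
  using assms
  by (simp add: boundary_map_eq linear_extension_linear free_module_is_module boundary_elem_closed)

lemma boundary_map_basis:
  assumes "cring R" "s \<in> simplices K (Suc n)"
  shows "boundary_map R K (Suc n) (basis_elem R s) = boundary_elem R K (Suc n) s"
  using assms
  by (simp add: boundary_map_eq linear_extension_basis free_module_is_module boundary_elem_closed)

lemma boundaries_submodule:
  assumes "cring R"
  shows "submodule (boundaries R K n) R (chain_module R K n)"
  unfolding boundaries_def
  using assms by (intro linear_image_submodule free_module_is_module boundary_map_linear)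

lemma boundary_elem_edge:
  assumes R: "cring R" and edge: "[x, y] \<in> K"
  shows "boundary_elem R K (Suc 0) [x, y] =
           basis_elem R [y] \<ominus>\<^bsub>chain_module R K 0\<^esub> basis_elem R [x]"
proof -
  interpret cring R by fact
  let ?C = "chain_module R K 0"
  interpret C: module R ?C by (rule free_module_is_module) fact
  have "[x] \<in> simplices K 0" "[y] \<in> simplices K 0"
    using singleton_simplex[OF edge] by (auto simp: simplices_def)
  then have e: "basis_elem R [x] \<in> carrier ?C" "basis_elem R [y] \<in> carrier ?C"
    by (simp_all add: basis_elem_closed R)
  have del: "del_nth 0 [x, y] = [y]" "del_nth (Suc 0) [x, y] = [x]"
    by (simp_all add: del_nth_def)
  have "boundary_elem R K (Suc 0) [x, y] =
      (\<Oplus>\<^bsub>?C\<^esub>i\<in>{..Suc 0}. ((\<ominus>\<^bsub>R\<^esub> \<one>\<^bsub>R\<^esub>) [^]\<^bsub>R\<^esub> i) \<odot>\<^bsub>?C\<^esub> basis_elem R (del_nth i [x, y]))"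
    by (simp only: boundary_elem_def Let_def diff_Suc_1)
  also have "\<dots> = (\<ominus>\<^bsub>R\<^esub> \<one>\<^bsub>R\<^esub>) [^]\<^bsub>R\<^esub> (Suc 0) \<odot>\<^bsub>?C\<^esub> basis_elem R [x] \<oplus>\<^bsub>?C\<^esub>
      (\<ominus>\<^bsub>R\<^esub> \<one>\<^bsub>R\<^esub>) [^]\<^bsub>R\<^esub> (0::nat) \<odot>\<^bsub>?C\<^esub> basis_elem R [y]"
    using e del by (subst C.M.finsum_Suc) (auto simp: le_Suc_eq simp del: free_module_simps)
  also have "\<dots> = (\<ominus>\<^bsub>?C\<^esub> basis_elem R [x]) \<oplus>\<^bsub>?C\<^esub> basis_elem R [y]"
    using e by (simp add: C.smult_l_minus del: free_module_simps)
  also have "\<dots> = basis_elem R [y] \<ominus>\<^bsub>?C\<^esub> basis_elem R [x]"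
    using e by (simp add: C.minus_eq C.M.a_comm del: free_module_simps)
  finally show ?thesis .
qed

text \<open>The boundaries that identify the two ends of an edge in homology.\<close>

lemma boundary_edge:
  assumes "cring R" "[x, y] \<in> K"
  shows "basis_elem R [y] \<ominus>\<^bsub>chain_module R K 0\<^esub> basis_elem R [x] \<in> boundaries R K 0"
proof -
  have s: "[x, y] \<in> simplices K (Suc 0)"
    using assms by (simp add: simplices_def)
  show ?thesis
    unfolding boundaries_def boundary_elem_edge[OF assms, symmetric]
      boundary_map_basis[OF assms(1) s, symmetric]
    using assms s by (intro imageI basis_elem_closed)
qed

theorem homology_0_iso:
  assumes R: "cring R"
  shows "modules_isomorphic R (homology R K 0) (power_module R (card (weak_components V K)))"
proof -
  define k where "k = card (weak_components V K)"
  let ?C = "chain_module R K 0" and ?B = "boundaries R K 0" and ?N = "power_module R k"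
  have C: "module R ?C" and N: "module R ?N"
    using R by (simp_all add: free_module_is_module)
  have B: "submodule ?B R ?C"
    using R by (rule boundaries_submodule)
  interpret C: module R ?C by fact
  interpret N: module R ?N by fact
  have vertex: "[v] \<in> simplices K 0" if "v \<in> V" for v
    using that by (simp add: simplices_0)

  obtain h where h: "bij_betw h (weak_components V K) {..<k}"
    using ex_bij_betw_finite_nat[OF finite_weak_components] by (auto simp: k_def atLeast0LessThan)
  define idx where "idx v = h (path_rel V K `` {v})" for v
  have comp_class: "path_rel V K `` {v} \<in> weak_components V K" if "v \<in> V" for v
    using that by (simp add: weak_components_def quotientI)
  have idx_less: "idx v < k" if "v \<in> V" for v
    using bij_betwE[OF h] comp_class[OF that] by (auto simp: idx_def)
  have idx_eq: "idx v = idx w \<longleftrightarrow> (v, w) \<in> path_rel V K" if "v \<in> V" "w \<in> V" for v w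
    using that comp_class bij_betw_imp_inj_on[OF h] eq_equiv_class_iff[OF equiv_path_rel]
    by (auto simp: idx_def inj_on_eq_iff)
  have "\<exists>v. v \<in> V \<and> idx v = j" if "j < k" for j
  proof -
    have "j \<in> h ` weak_components V K"
      using that by (simp add: bij_betw_imp_surj_on[OF h])
    then obtain A where A: "A \<in> weak_components V K" "h A = j"
      by auto
    from A(1)[unfolded weak_components_def] show ?thesis
    proof (rule quotientE)
      fix v assume "A = path_rel V K `` {v}" "v \<in> V"
      with A(2) show ?thesis
        by (intro exI[of _ v]) (simp add: idx_def)
    qed
  qed
  then obtain rep where rep: "\<And>j. j < k \<Longrightarrow> rep j \<in> V" "\<And>j. j < k \<Longrightarrow> idx (rep j) = j"
    by metis

  \<comment> \<open>\<open>\<epsilon>\<close> adds up the coefficients within each component; \<open>hd\<close> recovers \<open>v\<close> from the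
    \<open>0\<close>-simplex \<open>[v]\<close>.\<close>
  define \<epsilon> where "\<epsilon> = linear_extension R ?N (\<lambda>s. basis_elem R (idx (hd s)))"
  define \<sigma> where "\<sigma> = linear_extension R ?C (\<lambda>j. basis_elem R [rep j])"
  have \<epsilon>: "\<epsilon> \<in> linear_maps R ?C ?N"
    unfolding \<epsilon>_def
    by (rule linear_extension_linear[OF N])
       (use idx_less in \<open>auto simp: simplices_0 intro!: basis_elem_closed[OF R]\<close>)
  have \<sigma>: "\<sigma> \<in> linear_maps R ?N ?C"
    unfolding \<sigma>_def
    by (rule linear_extension_linear[OF C])
       (use rep vertex in \<open>auto intro!: basis_elem_closed[OF R]\<close>)
  have \<epsilon>_vertex: "\<epsilon> (basis_elem R [v]) = basis_elem R (idx v)" if "v \<in> V" for v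
    unfolding \<epsilon>_def using that idx_less
    by (subst linear_extension_basis[OF N]) (auto intro!: basis_elem_closed[OF R])
  have \<sigma>_index: "\<sigma> (basis_elem R j) = basis_elem R [rep j]" if "j < k" for j
    unfolding \<sigma>_def using that rep vertex
    by (subst linear_extension_basis[OF C]) (auto intro!: basis_elem_closed[OF R])

  have \<epsilon>_\<sigma>: "\<epsilon> (\<sigma> d) = d" if "d \<in> carrier ?N" for d
  proof (rule linear_maps_eqI[OF R N _ _ _ that])
    show "(\<lambda>d. \<epsilon> (\<sigma> d)) \<in> linear_maps R ?N ?N"
      using \<sigma> \<epsilon> by (rule linear_maps_compose)
    show "(\<lambda>d. d) \<in> linear_maps R ?N ?N"
      by (simp add: linear_maps_def)
    show "\<epsilon> (\<sigma> (basis_elem R j)) = basis_elem R j" if "j \<in> {..<k}" for j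
      using that rep by (simp add: \<sigma>_index \<epsilon>_vertex)
  qed
  have surj: "\<epsilon> ` carrier ?C = carrier ?N"
  proof
    show "\<epsilon> ` carrier ?C \<subseteq> carrier ?N"
      using linear_mapsD(1)[OF \<epsilon>] by blast
    show "carrier ?N \<subseteq> \<epsilon> ` carrier ?C"
      using \<epsilon>_\<sigma> linear_mapsD(1)[OF \<sigma>] by (metis image_eqI subsetI)
  qed

  have \<epsilon>_boundary: "\<epsilon> (boundary_map R K (Suc 0) c) = \<zero>\<^bsub>?N\<^esub>"
    if "c \<in> carrier (chain_module R K (Suc 0))" for c
  proof (rule linear_maps_eqI[OF R N _ _ _ that])
    show "(\<lambda>c. \<epsilon> (boundary_map R K (Suc 0) c)) \<in> linear_maps R (chain_module R K (Suc 0)) ?N"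
      using boundary_map_linear[OF R] \<epsilon> by (rule linear_maps_compose)
    show "(\<lambda>c. \<zero>\<^bsub>?N\<^esub>) \<in> linear_maps R (chain_module R K (Suc 0)) ?N"
      by (simp add: linear_maps_def del: free_module_simps)
    fix s assume s: "s \<in> simplices K (Suc 0)"
    then obtain x y where xy: "s = [x, y]" "[x, y] \<in> K"
      by (auto simp: simplices_def length_Suc_conv)
    then have V: "x \<in> V" "y \<in> V"
      using simplices_in_vertices[OF xy(2)] by auto
    have "\<epsilon> (boundary_map R K (Suc 0) (basis_elem R s)) =
        \<epsilon> (basis_elem R [y] \<ominus>\<^bsub>?C\<^esub> basis_elem R [x])"
      using s xy R by (simp only: boundary_map_basis boundary_elem_edge)
    also have "\<dots> = basis_elem R (idx y) \<ominus>\<^bsub>?N\<^esub> basis_elem R (idx x)"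
      using V by (simp only: linear_maps_minus[OF C N \<epsilon>] basis_elem_closed[OF R] vertex \<epsilon>_vertex)
    also have "idx y = idx x"
      using edge_in_path_rel[OF xy(2)] idx_eq[OF V] by simp
    also have "basis_elem R (idx x) \<ominus>\<^bsub>?N\<^esub> basis_elem R (idx x) = \<zero>\<^bsub>?N\<^esub>"
      using V idx_less
      by (simp only: N.minus_eq N.M.r_neg basis_elem_closed[OF R] lessThan_iff)
    finally show "\<epsilon> (boundary_map R K (Suc 0) (basis_elem R s)) = \<zero>\<^bsub>?N\<^esub>" .
  qed

  \<comment> \<open>Replacing each vertex by the representative of its component does not change the
    homology class.\<close>
  have retract: "?B +>\<^bsub>?C\<^esub> \<sigma> (\<epsilon> c) = ?B +>\<^bsub>?C\<^esub> c" if "c \<in> carrier ?C" for c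
  proof (rule linear_maps_eqI[OF R module_quotient_module[OF C B] _ _ _ that])
    show "(\<lambda>c. ?B +>\<^bsub>?C\<^esub> c) \<in> linear_maps R ?C (quotient_module ?C ?B)"
      using C B by (rule coset_map_linear)
    then show "(\<lambda>c. ?B +>\<^bsub>?C\<^esub> \<sigma> (\<epsilon> c)) \<in> linear_maps R ?C (quotient_module ?C ?B)"
      using linear_maps_compose[OF \<epsilon> \<sigma>] by (rule linear_maps_compose[rotated])
    fix s assume "s \<in> simplices K 0"
    then obtain v where v: "v \<in> V" "s = [v]"
      by (auto simp: simplices_0)
    have "(rep (idx v), v) \<in> path_rel V K"
      using v idx_eq[of "rep (idx v)" v] rep[OF idx_less[OF v(1)]] by blast
    then have "?B +>\<^bsub>?C\<^esub> basis_elem R [rep (idx v)] = ?B +>\<^bsub>?C\<^esub> basis_elem R [v]"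
    proof (rule path_invariant[where F = "\<lambda>v. ?B +>\<^bsub>?C\<^esub> basis_elem R [v]"])
      fix x y assume xy: "[x, y] \<in> K"
      then have "x \<in> V" "y \<in> V"
        using simplices_in_vertices[OF xy] by auto
      then have "?B +>\<^bsub>?C\<^esub> basis_elem R [y] = ?B +>\<^bsub>?C\<^esub> basis_elem R [x]"
        using boundary_edge[OF R xy]
        by (simp only: coset_eq_iff[OF C B] basis_elem_closed[OF R] vertex)
      then show "?B +>\<^bsub>?C\<^esub> basis_elem R [x] = ?B +>\<^bsub>?C\<^esub> basis_elem R [y]" ..
    qed
    then show "?B +>\<^bsub>?C\<^esub> \<sigma> (\<epsilon> (basis_elem R s)) = ?B +>\<^bsub>?C\<^esub> basis_elem R s"
      using v idx_less by (simp add: \<epsilon>_vertex \<sigma>_index)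
  qed

  have ker: "\<epsilon> c = \<zero>\<^bsub>?N\<^esub> \<longleftrightarrow> c \<in> ?B" if c: "c \<in> carrier ?C" for c
  proof
    assume "\<epsilon> c = \<zero>\<^bsub>?N\<^esub>"
    then have "?B +>\<^bsub>?C\<^esub> c = ?B +>\<^bsub>?C\<^esub> \<zero>\<^bsub>?C\<^esub>"
      using retract[OF c] linear_maps_zero[OF N C \<sigma>] by (simp only:)
    then show "c \<in> ?B"
      using c C.M.add.inv_one
      by (simp only: coset_eq_iff[OF C B] C.M.zero_closed C.minus_eq C.M.r_zero
          a_inv_def[symmetric])
  next
    assume "c \<in> ?B"
    then show "\<epsilon> c = \<zero>\<^bsub>?N\<^esub>"
      using \<epsilon>_boundary by (auto simp only: boundaries_def)
  qed
  show ?thesis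
    unfolding homology_0 k_def[symmetric]
    using C N B \<epsilon> surj ker by (rule first_isomorphism_theorem)
qed

text \<open>A vertex, as a chain, has coefficients 0 and 1 and is therefore a directed cycle; a
  submodule containing the classes of all vertices contains every class.\<close>

theorem homology_0_eq_dir_homology_0:
  fixes R :: "('r::linordered_idom) ring"
  assumes R: "R = ring_of_type_algebra"
  shows "homology R K 0 = dir_homology R K 0"
proof -
  have cring: "cring R"
    unfolding R by (rule cring_from_type_algebra)
  let ?C = "chain_module R K 0" and ?B = "boundaries R K 0"
  let ?H = "quotient_module ?C ?B" and ?D = "homology_class R K 0 ` dir_cycles R K 0"
  have C: "module R ?C" and B: "submodule ?B R ?C"
    using cring by (simp_all add: free_module_is_module boundaries_submodule)
  have H: "module R ?H"
    using C B by (rule module_quotient_module)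
  note coset = coset_map_linear[OF C B]
  have class_def: "homology_class R K 0 = (\<lambda>c. ?B +>\<^bsub>?C\<^esub> c)"
    by (simp add: fun_eq_iff homology_class_def cycle_module_0)
  have D: "?D \<subseteq> carrier ?H"
    using linear_mapsD(1)[OF coset] by (auto simp: class_def dir_cycles_def cycles_0)
  have vertex: "?B +>\<^bsub>?C\<^esub> basis_elem R s \<in> ?D" if "s \<in> simplices K 0" for s
  proof -
    have "basis_elem R s \<in> dir_cycles R K 0"
      using basis_elem_closed[OF cring that]
      by (auto simp: dir_cycles_def cycles_0 basis_elem_def R ring_of_type_algebra_def)
    then show ?thesis
      unfolding class_def by (rule imageI)
  qed
  have "generated_submodule R ?H ?D = carrier ?H"
  proof
    show "generated_submodule R ?H ?D \<subseteq> carrier ?H"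
      using module.carrier_is_submodule[OF H] D by (auto simp: generated_submodule_def)
    have "carrier ?H \<subseteq> N" if N: "submodule N R ?H" and "?D \<subseteq> N" for N
    proof -
      have "?B +>\<^bsub>?C\<^esub> c \<in> N" if "c \<in> carrier ?C" for c
        using vertex \<open>?D \<subseteq> N\<close> by (intro linear_map_into_submodule[OF cring H coset N _ that]) auto
      then show ?thesis
        by (auto simp: quotient_module_simps(1)[OF C B])
    qed
    then show "carrier ?H \<subseteq> generated_submodule R ?H ?D"
      by (auto simp: generated_submodule_def)
  qed
  then show ?thesis
    by (simp add: dir_homology_def homology_0)
qed

corollary dir_homology_0_iso:
  fixes R :: "('r::linordered_idom) ring"
  assumes "R = ring_of_type_algebra"
  shows "modules_isomorphic R (dir_homology R K 0) (power_module R (card (weak_components V K)))"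
proof -
  have "cring R"
    unfolding assms by (rule cring_from_type_algebra)
  then show ?thesis
    unfolding homology_0_eq_dir_homology_0[OF assms, symmetric] by (rule homology_0_iso)
qed

end

theorem proposition3p18:
  fixes V :: "'v set" and K :: "'v list set" and R :: "('r, 'm) ring_scheme" and k :: nat
  assumes "directed_simplicial_complex V K"
    and "cring R"
    and "k = card (weak_components V K)"
  shows "modules_isomorphic R (homology R K 0) (power_module R k) \<and>
    (let Z = (ring_of_type_algebra :: int ring) in
       homology Z K 0 = dir_homology Z K 0 \<and>
       modules_isomorphic Z (dir_homology Z K 0) (power_module Z k)) \<and>
    (let Q = (ring_of_type_algebra :: rat ring) in
       homology Q K 0 = dir_homology Q K 0 \<and>
       modules_isomorphic Q (dir_homology Q K 0) (power_module Q k)) \<and>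
    (let S = (ring_of_type_algebra :: real ring) in
       homology S K 0 = dir_homology S K 0 \<and>
       modules_isomorphic S (dir_homology S K 0) (power_module S k))"
proof -
  interpret directed_simplicial_complex V K by fact
  show ?thesis
    unfolding Let_def assms(3)
    by (intro conjI homology_0_iso[OF assms(2)] homology_0_eq_dir_homology_0 dir_homology_0_iso refl)
qed

end
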